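(* Let $S$ be a finite weakly ordered monoid with associated upper semi-lattice $(\mathcal{L},\preceq)$ and maps $C,D:S\to\mathcal{L}$, and let $\mathcal{G}$ be a generating set of $S$ with a fixed total order. For $J\in\mathcal{L}$ let $e_J\in\mathbb{C}S$ be the element defined recursively (downward on $\mathcal{L}$) by $e_J=P_J\bigl(1-\sum_{K\succ J}e_K\bigr)$, where $P_J$ is as defined in the context. Then the set $\{e_J : J\in\mathcal{L}\}$ is a complete system of primitive orthogonal idempotents for the monoid algebra $\mathbb{C}S$.
   Context: Preorder: for $u,v$ in a monoid $S$, $u\le v$ means there is $w\in S$ with $uw=v$. Weakly ordered monoid: a finite monoid $S$ together with a finite upper semi-lattice $(\mathcal{L},\preceq)$ (a finite poset in which any two elements have a join $\vee$) and two maps $C,D:S\to\mathcal{L}$ such that: (1) $C(uv)=C(u)\vee C(v)$ for all $u,v\in S$; (2) $C$ is surjective; (3) if $uv\le u$ then $C(v)\preceq D(u)$; (4) if $C(v)\preceq D(u)$ then $uv=u$. Omega powers: for $x$ in a finite monoid, $x^\omega$ is the (unique) idempotent among the powers $x,x^2,x^3,\dots$. If $x\in\mathbb{C}S$ and $x^{N+1}=x^N$ for some $N$, we also write $x^\omega$ for $x^N$. Products over subsets of $\mathcal{G}$ are taken in the fixed total order on $\mathcal{G}$; an empty product is $1$. For $J\in\mathcal{L}$ define $$T_J=\Bigl(\prod_{g\in\mathcal{G},\,C(g)\preceq J}g^\omega\Bigr)^\omega\in S,\qquad B_J=\prod_{g\in\mathcal{G},\,C(g)\not\preceq J}(1-g^\omega)\in\mathbb{C}S,\qquad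 A_J=B_J^\omega,\qquad z_J=A_JT_J$$ (there is $N$ with $B_J^{N+1}=B_J^N$, so $A_J$ is well defined), and $$P_J=\sum_{n,m\ge0}(1-z_J)^{n+m}z_J^2=\sum_{k\ge0}(k+1)(1-z_J)^kz_J^2,$$ where only finitely many summands are nonzero. A set of nonzero elements $\{e_J:J\in\mathcal{I}\}$ of a finite-dimensional unital algebra $A$ is a complete system of primitive orthogonal idempotents for $A$ if: $e_J^2=e_J$ for all $J$; $e_Je_K=0$ for $J\ne K$; each $e_J$ is primitive (if $e_J=x+y$ with $x,y$ orthogonal idempotents of $A$, then $x=0$ or $y=0$); and $\sum_{J\in\mathcal{I}}e_J=1$. *)

theory Defs
  imports Complex_Main "HOL-Library.Poly_Mapping"
begin

text \<open>
  \<^typ>\<open>'a \<Rightarrow>\<^sub>0 'b\<close> is the monoid algebra of \<open>'a\<close> over \<open>'b\<close>, but it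
  expects the (possibly noncommutative) monoid \<open>'a\<close> to be written additively.  The type copy
  below turns a multiplicative monoid into an additive one.
\<close>

typedef 'a additive = "UNIV :: 'a set"
  morphisms of_additive Additive ..

setup_lifting type_definition_additive

instantiation additive :: (monoid_mult) monoid_add
begin

lift_definition zero_additive :: "'a additive" is 1 .
lift_definition plus_additive :: "'a additive \<Rightarrow> 'a additive \<Rightarrow> 'a additive" is "(*)" .

instance
  by standard (transfer; simp add: mult.assoc)+

end

type_synonym 'a monoid_algebra = "'a additive \<Rightarrow>\<^sub>0 complex"

definition emb :: "'a::monoid_mult \<Rightarrow> 'a monoid_algebra" where
  "emb s = Poly_Mapping.single (Additive s) 1"

lemma emb_one: "emb 1 = 1"
  by (simp add: emb_def zero_additive_def flip: single_one)

lemma emb_mult: "emb (s * t) = emb s * emb t"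
  by (simp add: emb_def mult_single plus_additive.abs_eq)


definition monoid_le :: "'a::monoid_mult \<Rightarrow> 'a \<Rightarrow> bool" where
  "monoid_le u v \<longleftrightarrow> (\<exists>w. u * w = v)"

locale weakly_ordered_monoid =
  fixes C D :: "'a::{monoid_mult, finite} \<Rightarrow> 'l::{semilattice_sup, finite}"
  assumes C_mult: "C (u * v) = sup (C u) (C v)"
    and surj_C: "surj C"
    and C_le_D: "monoid_le (u * v) u \<Longrightarrow> C v \<le> D u"
    and mult_absorb: "C v \<le> D u \<Longrightarrow> u * v = u"

definition generates :: "'a::monoid_mult set \<Rightarrow> bool" where
  "generates G \<longleftrightarrow> (\<lambda>M. 1 \<in> M \<and> (\<forall>x\<in>M. \<forall>y\<in>M. x * y \<in> M)) hull G = UNIV"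


definition omega :: "'a::monoid_mult \<Rightarrow> 'a" where
  "omega x = (THE y. (\<exists>n\<ge>1. y = x ^ n) \<and> y * y = y)"

definition alg_omega :: "'b::ring_1 \<Rightarrow> 'b" where
  "alg_omega x = (THE y. \<exists>N. x ^ (N + 1) = x ^ N \<and> y = x ^ N)"

text \<open>
  The total order on the generators is a reflexive relation \<open>r\<close> with
  \<^term>\<open>linear_order_on G r\<close>.  For finite \<open>H \<subseteq> G\<close>, \<open>ordered_list r H\<close> lists \<open>H\<close>
  increasingly and \<open>ordered_prod r f H\<close> multiplies the values of \<open>f\<close> in that order.
\<close>

definition ordered_list :: "'a rel \<Rightarrow> 'a set \<Rightarrow> 'a list" where
  "ordered_list r H = (THE xs. set xs = H \<and> distinct xs \<and> sorted_wrt (\<lambda>x y. (x, y) \<in> r) xs)"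

definition ordered_prod :: "'a rel \<Rightarrow> ('a \<Rightarrow> 'b::monoid_mult) \<Rightarrow> 'a set \<Rightarrow> 'b" where
  "ordered_prod r f H = prod_list (map f (ordered_list r H))"


context
  fixes G :: "'a::{monoid_mult, finite} set" and r :: "'a rel"
    and C :: "'a \<Rightarrow> 'l::{semilattice_sup, finite}"
begin

definition T_elt :: "'l \<Rightarrow> 'a" where
  "T_elt J = omega (ordered_prod r omega {g \<in> G. C g \<le> J})"

definition B_elt :: "'l \<Rightarrow> 'a monoid_algebra" where
  "B_elt J = ordered_prod r (\<lambda>g. 1 - emb (omega g)) {g \<in> G. \<not> C g \<le> J}"

definition A_elt :: "'l \<Rightarrow> 'a monoid_algebra" where
  "A_elt J = alg_omega (B_elt J)"

definition z_elt :: "'l \<Rightarrow> 'a monoid_algebra" where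
  "z_elt J = A_elt J * emb (T_elt J)"

text \<open>\<^const>\<open>Sum_any\<close> is the sum over all pairs of a family with finitely many nonzero members.\<close>

definition P_elt :: "'l \<Rightarrow> 'a monoid_algebra" where
  "P_elt J = Sum_any (\<lambda>(n, m). (1 - z_elt J) ^ (n + m) * (z_elt J)\<^sup>2)"

function e_elt :: "'l \<Rightarrow> 'a monoid_algebra" where
  "e_elt J = P_elt J * (1 - (\<Sum>K\<in>{K. J < K}. e_elt K))"
  by auto
termination
proof (relation "measure (\<lambda>J. card {K. J < K})")
  fix J K :: 'l
  assume "K \<in> {K. J < K}"
  then have "{L. K < L} \<subset> {L. J < L}"
    by auto
  then show "(K, J) \<in> measure (\<lambda>J. card {K. J < K})"
    by (simp add: psubset_card_mono)
qed simp

declare e_elt.simps [simp del]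

end


definition primitive :: "'b::ring_1 \<Rightarrow> bool" where
  "primitive e \<longleftrightarrow>
    (\<forall>x y. x * x = x \<and> y * y = y \<and> x * y = 0 \<and> y * x = 0 \<and> e = x + y \<longrightarrow> x = 0 \<or> y = 0)"

definition complete_primitive_orthogonal_idempotents :: "'i set \<Rightarrow> ('i \<Rightarrow> 'b::ring_1) \<Rightarrow> bool" where
  "complete_primitive_orthogonal_idempotents I e \<longleftrightarrow>
    (\<forall>J\<in>I. e J \<noteq> 0) \<and>
    (\<forall>J\<in>I. (e J)\<^sup>2 = e J) \<and>
    (\<forall>J\<in>I. \<forall>K\<in>I. J \<noteq> K \<longrightarrow> e J * e K = 0) \<and>
    (\<forall>J\<in>I. primitive (e J)) \<and>
    (\<Sum>J\<in>I. e J) = 1"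

end

theory Submission
  imports Defs
begin

text \<open>
  For \<open>d\<close> in the semilattice, summing the coefficients over \<open>{s. C s \<le> d}\<close> is a character
  \<open>\<chi>\<^sub>d\<close> of the monoid algebra.  An element on which all characters vanish acts from the right
  strictly triangularly with respect to the \<open>\<R>\<close>-order, so an idempotent of that kind is \<open>0\<close>.  Since
  \<open>\<chi>\<^sub>d(z\<^sub>J)\<close>, and with it \<open>\<chi>\<^sub>d(e\<^sub>J)\<close>, is \<open>1\<close> for \<open>d = J\<close> and \<open>0\<close> otherwise, both primitivity and
  completeness follow from orthogonality.

  For orthogonality, call \<open>v\<close> killed by \<open>J\<close> if \<open>C g \<le> D v\<close> for some generator \<open>g\<close> with
  \<open>\<not> C g \<le> J\<close>.  The span of the killed elements is invariant and nilpotent under right multiplication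
  by \<open>B\<^sub>J\<close>, and \<open>u B\<^sub>J - u\<close> lies in it for the other \<open>u\<close>.  Hence \<open>A\<^sub>J\<close> exists and
  \<open>v A\<^sub>J = 0\<close> for killed \<open>v\<close>.  The same triangularity gives \<open>(1 - z\<^sub>J)\<^sup>N z\<^sub>J\<^sup>2 = 0\<close> for large \<open>N\<close>, so
  \<open>P\<^sub>J = (1 - (1 - z\<^sub>J)\<^sup>N)\<^sup>2\<close> is idempotent.  Finally \<open>T\<^sub>K\<close> is killed by \<open>J\<close> unless \<open>K \<le> J\<close>, so
  \<open>P\<^sub>K e\<^sub>J = 0\<close> unless \<open>K \<le> J\<close>, and downward induction on \<open>K\<close> gives \<open>e\<^sub>K e\<^sub>J = 0\<close> for all \<open>K \<noteq> J\<close>.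
\<close>

section \<open>Ordered products and omega powers\<close>

text \<open>\<open>ordered_list\<close> is a definite description, so it is usable only once the
  sorted list exists (insertion) and is unique (antisymmetry fixes the head).\<close>

lemma set_ordered_list_linear_order:
  assumes r: "linear_order_on G r" and "H \<subseteq> G" "finite H"
  shows "set (ordered_list r H) = H"
proof -
  have refl: "(x, x) \<in> r" if "x \<in> G" for x
    using r that by (auto simp: order_on_defs refl_on_def)
  have total: "(x, y) \<in> r \<or> (y, x) \<in> r" if "x \<in> G" "y \<in> G" for x y
    using r that refl by (cases "x = y") (auto simp: order_on_defs total_on_def)
  have trans: "(x, z) \<in> r" if "(x, y) \<in> r" "(y, z) \<in> r" for x y z
    using r that by (auto simp: order_on_defs dest: transD)
  have antisym: "x = y" if "(x, y) \<in> r" "(y, x) \<in> r" for x y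
    using r that by (auto simp: order_on_defs dest: antisymD)
  define Q where "Q H xs \<longleftrightarrow> set xs = H \<and> distinct xs \<and> sorted_wrt (\<lambda>x y. (x, y) \<in> r) xs" for H xs
  have "\<exists>xs. Q H xs"
    using \<open>finite H\<close> \<open>H \<subseteq> G\<close>
  proof (induction H rule: finite_induct)
    case empty
    then show ?case by (auto simp: Q_def)
  next
    case (insert a F)
    then obtain xs where xs: "set xs = F" "distinct xs" "sorted_wrt (\<lambda>x y. (x, y) \<in> r) xs"
      by (auto simp: Q_def)
    have mem: "x \<in> G" if "x = a \<or> x \<in> F" for x
      using insert.prems that by auto
    have ge: "(a, x) \<in> r" if "x \<in> F" "(x, a) \<notin> r" for x
      using total[of a x] mem that by auto
    have "Q (insert a F) (filter (\<lambda>x. (x, a) \<in> r) xs @ a # filter (\<lambda>x. (x, a) \<notin> r) xs)"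
      using xs insert.hyps ge trans[of _ a]
      by (simp add: Q_def sorted_wrt_append sorted_wrt_filter) blast
    then show ?case by blast
  qed
  moreover have "xs = ys" if "Q H xs" "Q H ys" for H xs ys
    using that
  proof (induction xs arbitrary: ys H)
    case Nil
    then show ?case by (auto simp: Q_def)
  next
    case (Cons x xs)
    then obtain y ys' where ys: "ys = y # ys'"
      by (cases ys) (auto simp: Q_def)
    have "x = y"
    proof (rule ccontr)
      assume "x \<noteq> y"
      then have "x \<in> set ys'" "y \<in> set xs"
        using Cons.prems ys by (auto simp: Q_def)
      then show False
        using Cons.prems ys \<open>x \<noteq> y\<close> antisym by (auto simp: Q_def)
    qed
    moreover have "xs = ys'"
    proof (rule Cons.IH)
      show "Q (H - {x}) xs" "Q (H - {x}) ys'"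
        using Cons.prems ys \<open>x = y\<close> by (auto simp: Q_def)
    qed
    ultimately show ?case using ys by simp
  qed
  ultimately have "\<exists>!xs. Q H xs" by blast
  from theI'[OF this] show ?thesis
    by (simp add: ordered_list_def Q_def)
qed

lemma exists_idempotent_power:
  fixes x :: "'a::{monoid_mult, finite}"
  shows "\<exists>n\<ge>1. x ^ n * x ^ n = x ^ n"
proof -
  have "\<not> inj (\<lambda>n::nat. x ^ n)"
    using finite_imageD[of "\<lambda>n::nat. x ^ n" UNIV] infinite_UNIV_nat by auto
  then obtain i j :: nat where ij: "i < j" "x ^ i = x ^ j"
    by (metis injI nat_neq_iff)
  define p where "p = j - i"
  have p: "p \<ge> 1" "x ^ (i + p) = x ^ i"
    using ij by (auto simp: p_def)
  have period: "x ^ (a + k * p) = x ^ a" if "a \<ge> i" for a k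
  proof (induction k)
    case (Suc k)
    have "x ^ (b + p) = x ^ b" if "b \<ge> i" for b
    proof -
      have "x ^ (b + p) = x ^ (b - i) * x ^ (i + p)"
        using that by (simp flip: power_add)
      also have "\<dots> = x ^ b"
        using p that by (simp flip: power_add)
      finally show ?thesis .
    qed
    from this[of "a + k * p"] show ?case
      using Suc that by (simp add: add_ac)
  qed simp
  \<comment> \<open>A multiple of the period \<open>p\<close> that lies past the preperiod
    \<open>i\<close>, so doubling the exponent changes nothing.\<close>
  define n where "n = (i + 1) * p"
  have "n \<ge> i" "n \<ge> 1"
    using p(1) mult_le_mono[of i "i + 1" 1 p] by (auto simp: n_def)
  then have "x ^ n * x ^ n = x ^ n"
    using period[of n "i + 1"] by (simp add: n_def power_add)
  with \<open>n \<ge> 1\<close> show ?thesis by blast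
qed

lemma
  fixes x :: "'a::{monoid_mult, finite}"
  shows omega_is_power: "\<exists>n\<ge>1. omega x = x ^ n"
    and omega_idem: "omega x * omega x = omega x"
proof -
  have idem: "(x ^ n) ^ k = x ^ n" if "x ^ n * x ^ n = x ^ n" "k \<ge> 1" for n k
    using that(2) by (induction k rule: dec_induct) (auto simp: that(1))
  \<comment> \<open>Both idempotent powers equal \<open>x ^ (n * m)\<close>.\<close>
  have "y = z" if "n \<ge> 1" "y = x ^ n" "y * y = y" "m \<ge> 1" "z = x ^ m" "z * z = z" for y z n m
    using that idem[of n m] idem[of m n] by (metis mult.commute power_mult)
  then have "\<exists>!y. (\<exists>n\<ge>1. y = x ^ n) \<and> y * y = y"
    using exists_idempotent_power[of x] by blast
  from theI'[OF this] show "\<exists>n\<ge>1. omega x = x ^ n" "omega x * omega x = omega x"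
    by (simp_all add: omega_def)
qed

lemma power_stable:
  fixes x :: "'b::ring_1"
  assumes "x ^ (N + 1) = x ^ N" "N \<le> M"
  shows "x ^ M = x ^ N"
  using assms(2)
proof (induction M rule: dec_induct)
  case (step m)
  then show ?case using assms(1) by simp
qed simp

lemma alg_omega_eq:
  fixes x :: "'b::ring_1"
  assumes "x ^ (N + 1) = x ^ N"
  shows "alg_omega x = x ^ N"
  unfolding alg_omega_def
proof (rule the_equality)
  show "\<exists>N'. x ^ (N' + 1) = x ^ N' \<and> x ^ N = x ^ N'"
    using assms by blast
next
  fix y assume "\<exists>N'. x ^ (N' + 1) = x ^ N' \<and> y = x ^ N'"
  then obtain N' where "x ^ (N' + 1) = x ^ N'" "y = x ^ N'" by blast
  then show "y = x ^ N"
    using power_stable[of x N "max N N'"] power_stable[of x N' "max N N'"] assms by simp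
qed

lemma sum_power_one_minus_mult:
  fixes z :: "'b::ring_1"
  shows "(\<Sum>n<N. (1 - z) ^ n) * z = 1 - (1 - z) ^ N"
proof (induction N)
  case (Suc N)
  have "(\<Sum>n<Suc N. (1 - z) ^ n) * z = 1 - (1 - z) ^ N + (1 - z) ^ N * z"
    by (simp add: distrib_right Suc)
  also have "\<dots> = 1 - (1 - z) ^ N * (1 - z)"
    by (simp add: right_diff_distrib)
  finally show ?case
    by (simp only: power_Suc2)
qed simp

section \<open>Supports and characters of the monoid algebra\<close>

definition coeff :: "'a monoid_algebra \<Rightarrow> 'a::monoid_mult \<Rightarrow> complex" where
  "coeff p s = Poly_Mapping.lookup p (Additive s)"

definition supp :: "'a monoid_algebra \<Rightarrow> 'a::monoid_mult set" where
  "supp p = {s. coeff p s \<noteq> 0}"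

lemma coeff_simps [simp]:
  "coeff 0 s = 0"
  "coeff (p + q) s = coeff p s + coeff q s"
  "coeff (- p) s = - coeff p s"
  "coeff (p - q) s = coeff p s - coeff q s"
  "coeff (Poly_Mapping.single (Additive t) c) s = (if s = t then c else 0)"
  "coeff (sum f I) s = (\<Sum>i\<in>I. coeff (f i) s)"
  "coeff (emb t) s = (if s = t then 1 else 0)"
  by (auto simp: coeff_def emb_def lookup_add lookup_minus lookup_single lookup_sum when_def
      Additive_inject)

lemma supp_zero [simp]: "supp 0 = {}"
  by (simp add: supp_def)

lemma supp_emb [simp]: "supp (emb s) = {s}"
  by (auto simp: supp_def)

lemma supp_uminus [simp]: "supp (- p) = supp p"
  by (simp add: supp_def)

lemma supp_add: "supp p \<subseteq> X \<Longrightarrow> supp q \<subseteq> X \<Longrightarrow> supp (p + q) \<subseteq> X"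
  and supp_diff: "supp p \<subseteq> X \<Longrightarrow> supp q \<subseteq> X \<Longrightarrow> supp (p - q) \<subseteq> X"
  by (force simp: supp_def)+

lemma monoid_algebra_expand:
  fixes p :: "'a::{monoid_mult, finite} monoid_algebra"
  shows "p = (\<Sum>s\<in>UNIV. Poly_Mapping.single (Additive s) (coeff p s))"
proof (rule poly_mapping_eqI)
  fix k :: "'a additive"
  obtain t where t: "k = Additive t" by (cases k) auto
  show "Poly_Mapping.lookup p k =
      Poly_Mapping.lookup (\<Sum>s\<in>UNIV. Poly_Mapping.single (Additive s) (coeff p s)) k"
    using coeff_simps(6)[of "\<lambda>s. Poly_Mapping.single (Additive s) (coeff p s)" UNIV t]
    by (simp add: t coeff_def[symmetric] sum.delta)
qed

lemma mult_single_Additive: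
  "Poly_Mapping.single (Additive s) c * Poly_Mapping.single (Additive t) d =
    Poly_Mapping.single (Additive (s * t)) (c * d)"
  by (simp add: mult_single plus_additive.abs_eq)

lemma monoid_algebra_mult_expand:
  fixes p q :: "'a::{monoid_mult, finite} monoid_algebra"
  shows "p * q = (\<Sum>s\<in>UNIV. \<Sum>t\<in>UNIV. Poly_Mapping.single (Additive (s * t)) (coeff p s * coeff q t))"
  by (subst monoid_algebra_expand[of p], subst monoid_algebra_expand[of q])
     (simp add: sum_product mult_single_Additive)

text \<open>Reduces questions about right multiplication by \<open>q\<close> to basis elements
  \<open>emb s\<close>; scalars are written as multiples of the unit.\<close>

lemma mult_expand_left:
  fixes p q :: "'a::{monoid_mult, finite} monoid_algebra"
  shows "p * q = (\<Sum>s\<in>UNIV. Poly_Mapping.single (Additive 1) (coeff p s) * (emb s * q))"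
proof -
  have "Poly_Mapping.single (Additive s) c = Poly_Mapping.single (Additive 1) c * emb s" for s :: 'a and c
    by (simp add: emb_def mult_single_Additive)
  then have "p = (\<Sum>s\<in>UNIV. Poly_Mapping.single (Additive 1) (coeff p s) * emb s)"
    by (subst monoid_algebra_expand[of p]) (intro sum.cong refl)
  then have "p * q = (\<Sum>s\<in>UNIV. Poly_Mapping.single (Additive 1) (coeff p s) * emb s) * q"
    by (rule arg_cong)
  then show ?thesis
    by (simp only: sum_distrib_right mult.assoc)
qed

lemma coeff_scale:
  fixes p :: "'a::{monoid_mult, finite} monoid_algebra"
  shows "coeff (Poly_Mapping.single (Additive 1) c * p) s = c * coeff p s"
proof -
  have "Poly_Mapping.single (Additive 1) c * p
      = (\<Sum>t\<in>UNIV. Poly_Mapping.single (Additive t) (c * coeff p t))"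
    by (subst monoid_algebra_expand[of p]) (simp add: sum_distrib_left mult_single_Additive)
  then show ?thesis by simp
qed

lemma coeff_emb_mult:
  fixes p :: "'a::{monoid_mult, finite} monoid_algebra"
  shows "coeff (emb u * p) v = (\<Sum>t | u * t = v. coeff p t)"
proof -
  have "emb u * p = (\<Sum>t\<in>UNIV. Poly_Mapping.single (Additive (u * t)) (coeff p t))"
    by (subst monoid_algebra_expand[of p]) (simp add: sum_distrib_left emb_def mult_single_Additive)
  then have "coeff (emb u * p) v = (\<Sum>t\<in>UNIV. if u * t = v then coeff p t else 0)"
    by (auto intro: sum.cong)
  then show ?thesis by (simp add: sum.If_cases)
qed

lemma mult_eq_0_of_supp:
  fixes p q :: "'a::{monoid_mult, finite} monoid_algebra"
  assumes "\<And>s. s \<in> supp p \<Longrightarrow> emb s * q = 0"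
  shows "p * q = 0"
proof -
  have "Poly_Mapping.single (Additive 1) (coeff p s) * (emb s * q) = 0" for s
    using assms[of s] by (cases "coeff p s = 0") (auto simp: supp_def)
  then show ?thesis
    by (subst mult_expand_left) simp
qed

lemma supp_mult_subset:
  fixes p q :: "'a::{monoid_mult, finite} monoid_algebra"
  assumes "\<And>s. s \<in> supp p \<Longrightarrow> supp (emb s * q) \<subseteq> Y"
  shows "supp (p * q) \<subseteq> Y"
proof
  fix v assume "v \<in> supp (p * q)"
  then have "(\<Sum>s\<in>UNIV. coeff p s * coeff (emb s * q) v) \<noteq> 0"
    by (subst (asm) mult_expand_left) (simp add: supp_def coeff_scale)
  then obtain s where "coeff p s * coeff (emb s * q) v \<noteq> 0"
    by (meson sum.neutral)
  then show "v \<in> Y"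
    using assms[of s] by (auto simp: supp_def)
qed

lemma supp_mult_emb:
  fixes p :: "'a::{monoid_mult, finite} monoid_algebra"
  shows "supp (p * emb t) \<subseteq> (\<lambda>s. s * t) ` supp p"
  by (rule supp_mult_subset) (auto simp flip: emb_mult)

text \<open>If \<open>C (s * t)\<close> is the join of \<open>C s\<close> and \<open>C t\<close>, then \<open>{s. C s \<le> d}\<close> is a submonoid whose
  complement is an ideal, and the following functional is a character.\<close>

definition chi :: "('a::{monoid_mult, finite} \<Rightarrow> 'l::order) \<Rightarrow> 'l \<Rightarrow> 'a monoid_algebra \<Rightarrow> complex" where
  "chi C d p = (\<Sum>s | C s \<le> d. coeff p s)"

lemma chi_simps [simp]:
  "chi C d 0 = 0"
  "chi C d (p + q) = chi C d p + chi C d q"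
  "chi C d (p - q) = chi C d p - chi C d q"
  "chi C d (emb s) = (if C s \<le> d then 1 else 0)"
  "chi C d (Poly_Mapping.single (Additive s) c) = (if C s \<le> d then c else 0)"
  by (simp_all add: chi_def sum.distrib sum_subtractf)

lemma chi_sum: "chi C d (sum f I) = (\<Sum>i\<in>I. chi C d (f i))"
  by (simp add: chi_def sum.swap[of _ I])

context weakly_ordered_monoid
begin

section \<open>Consequences of the axioms: absorption, characters, heights\<close>

lemma C_one_le: "C 1 \<le> l"
proof -
  obtain s where "l = C s" using surj_C by (metis surjD)
  then show ?thesis using C_mult[of 1 s] by (metis mult.left_neutral sup.cobounded1)
qed

lemma C_power: "n \<ge> 1 \<Longrightarrow> C (x ^ n) = C x"
  by (induction n rule: dec_induct) (simp_all add: C_mult)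

lemma C_omega [simp]: "C (omega x) = C x"
  using omega_is_power[of x] C_power by metis

lemma absorb_iff: "u * v = u \<longleftrightarrow> C v \<le> D u"
  using C_le_D[of u v] mult_absorb[of v u] by (metis monoid_le_def mult.right_neutral)

lemma chi_one [simp]: "chi C d 1 = 1"
  using chi_simps(4)[of C d 1] C_one_le by (simp add: emb_one)

lemma chi_mult [simp]: "chi C d (p * q) = chi C d p * chi C d q"
proof -
  have "chi C d (p * q) =
      (\<Sum>s\<in>UNIV. \<Sum>t\<in>UNIV. if C s \<le> d \<and> C t \<le> d then coeff p s * coeff q t else 0)"
    by (subst monoid_algebra_mult_expand) (simp add: chi_sum C_mult)
  also have "\<dots> = (\<Sum>s\<in>UNIV. \<Sum>t\<in>UNIV. (if C s \<le> d then coeff p s else 0) *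
      (if C t \<le> d then coeff q t else 0))"
    by (intro sum.cong) auto
  also have "\<dots> = chi C d p * chi C d q"
    by (simp add: chi_def sum.If_cases flip: sum_product)
  finally show ?thesis .
qed

lemma chi_power [simp]: "chi C d (p ^ n) = chi C d p ^ n"
  by (induction n) simp_all

text \<open>The size of the right ideal generated by \<open>u\<close>, a rank for induction along
  the \<R>-order.\<close>

definition height :: "'a \<Rightarrow> nat" where
  "height u = card {v. monoid_le u v}"

text \<open>If \<open>u\<close> were reachable from \<open>u * w\<close>, axiom
  \<open>C_le_D\<close> would give \<open>C w \<le> D u\<close>, and then \<open>u * w = u\<close>
  by \<open>mult_absorb\<close>.\<close>

lemma height_mult_less:
  assumes "u * w \<noteq> u"
  shows "height (u * w) < height u"
  unfolding height_def
proof (rule psubset_card_mono)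
  have "u \<notin> {v. monoid_le (u * w) v}"
    using assms C_le_D mult_absorb by blast
  moreover have "u \<in> {v. monoid_le u v}"
    by (auto simp: monoid_le_def intro: exI[of _ 1])
  moreover have "{v. monoid_le (u * w) v} \<subseteq> {v. monoid_le u v}"
    by (auto simp: monoid_le_def mult.assoc)
  ultimately show "{v. monoid_le (u * w) v} \<subset> {v. monoid_le u v}" by blast
qed simp

lemma height_mult_le: "height (u * w) \<le> height u"
  using height_mult_less[of u w] by (cases "u * w = u") auto

lemma height_bound: "height u < Suc (card (UNIV :: 'a set))"
  by (simp add: height_def card_mono less_Suc_eq_le)

text \<open>Each factor \<open>p\<close> lowers the height, which is at most the size of the monoid,
  so one step more suffices. The factor \<open>t\<close> disposes of the basis elements that
  \<open>p\<close> need not lower; since it commutes with \<open>p\<close>, it can be moved next to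
  them.\<close>

lemma raising_nilpotent:
  fixes p q t :: "'a monoid_algebra"
  assumes step: "\<And>u. u \<in> X \<Longrightarrow> emb u * t = 0 \<or> supp (emb u * p) \<subseteq> {v \<in> X. height v < height u}"
    and comm: "p * t = t * p" and q: "supp q \<subseteq> X"
  shows "q * p ^ Suc (card (UNIV :: 'a set)) * t = 0"
proof -
  have *: "emb u * (p ^ N * t) = 0" if "u \<in> X" "height u < N" for N u
    using that
  proof (induction N arbitrary: u)
    case (Suc N)
    from step[OF \<open>u \<in> X\<close>] show ?case
    proof
      assume "emb u * t = 0"
      then show ?thesis
        using power_commuting_commutes[OF comm, of "Suc N"] by (metis mult.assoc mult_zero_left)
    next
      assume sub: "supp (emb u * p) \<subseteq> {v \<in> X. height v < height u}"
      have "emb u * p * (p ^ N * t) = 0"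
      proof (rule mult_eq_0_of_supp)
        fix s assume "s \<in> supp (emb u * p)"
        then show "emb s * (p ^ N * t) = 0"
          using sub Suc.prems by (intro Suc.IH) auto
      qed
      then show ?thesis by (simp add: mult.assoc)
    qed
  qed simp
  then have "q * (p ^ Suc (card (UNIV :: 'a set)) * t) = 0"
    using q height_bound by (intro mult_eq_0_of_supp[of q] *) auto
  then show ?thesis by (simp add: mult.assoc)
qed

text \<open>Such an \<open>x\<close> acts from the right with zero diagonal, hence nilpotently.\<close>

lemma idempotent_eq_0:
  fixes x :: "'a monoid_algebra"
  assumes idem: "x * x = x" and chi: "\<And>d. chi C d x = 0"
  shows "x = 0"
proof -
  have "supp (emb u * x) \<subseteq> {v \<in> UNIV. height v < height u}" for u
  proof
    fix v assume v: "v \<in> supp (emb u * x)"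
    then have "(\<Sum>t | u * t = v. coeff x t) \<noteq> 0"
      by (simp add: supp_def coeff_emb_mult)
    then obtain t where t: "v = u * t"
      by (metis (mono_tags, lifting) mem_Collect_eq sum.neutral)
    \<comment> \<open>By \<open>absorb_iff\<close>, the coefficient of \<open>emb u * x\<close> at
      \<open>u\<close> is the character of \<open>x\<close> at \<open>D u\<close>.\<close>
    have "v \<noteq> u"
      using v chi[of "D u"] by (auto simp: supp_def coeff_emb_mult absorb_iff chi_def)
    then show "v \<in> {v \<in> UNIV. height v < height u}"
      using height_mult_less t by auto
  qed
  then have "1 * x ^ Suc (card (UNIV :: 'a set)) * 1 = 0"
    by (intro raising_nilpotent[of UNIV]) auto
  moreover have "x ^ Suc n = x" for n
    by (induction n) (simp_all add: idem)
  ultimately show ?thesis by simp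
qed

end

section \<open>The idempotents\<close>

locale ordered_generators = weakly_ordered_monoid C D
  for C D :: "'a::{monoid_mult, finite} \<Rightarrow> 'l::{semilattice_sup, finite}" +
  fixes G :: "'a set" and r :: "'a rel"
  assumes generates_G: "generates G" and linear_r: "linear_order_on G r"
begin

text \<open>The elements \<open>s\<close> satisfying this implication form a submonoid containing
  \<open>G\<close>. In effect, \<open>C s\<close> is the join of the values
  \<open>C g \<le> C s\<close> on generators.\<close>

lemma C_le_of_generators:
  assumes "\<And>g. g \<in> G \<Longrightarrow> C g \<le> C s \<Longrightarrow> C g \<le> l"
  shows "C s \<le> l"
proof -
  have "(\<lambda>M. 1 \<in> M \<and> (\<forall>x\<in>M. \<forall>y\<in>M. x * y \<in> M)) hull G \<subseteq>
      {s. (\<forall>g\<in>G. C g \<le> C s \<longrightarrow> C g \<le> l) \<longrightarrow> C s \<le> l}"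
    by (rule hull_minimal) (auto simp: C_mult C_one_le intro: le_supI1 le_supI2)
  then show ?thesis
    using generates_G assms by (auto simp: generates_def)
qed

lemma le_of_generators:
  assumes "\<And>g. g \<in> G \<Longrightarrow> C g \<le> d \<Longrightarrow> C g \<le> l"
  shows "d \<le> l"
  using C_le_of_generators[of _ l] assms surj_C by (metis surjD)

lemma set_ordered_list: "H \<subseteq> G \<Longrightarrow> set (ordered_list r H) = H"
  using set_ordered_list_linear_order[OF linear_r] by (simp add: finite_subset)

abbreviation "T \<equiv> T_elt G r C"
abbreviation "B \<equiv> B_elt G r C"
abbreviation "A \<equiv> A_elt G r C"
abbreviation "z \<equiv> z_elt G r C"
abbreviation "P \<equiv> P_elt G r C"
abbreviation "e \<equiv> e_elt G r C"

lemma T_idem: "T J * T J = T J"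
  by (simp add: T_elt_def omega_idem)

lemma C_prod_list_le_iff: "C (prod_list xs) \<le> l \<longleftrightarrow> (\<forall>x\<in>set xs. C x \<le> l)"
  by (induction xs) (simp_all add: C_mult C_one_le)

lemma C_T [simp]: "C (T J) = J"
proof -
  have le_iff: "C (T J) \<le> l \<longleftrightarrow> (\<forall>g\<in>G. C g \<le> J \<longrightarrow> C g \<le> l)" for l
    by (auto simp: T_elt_def ordered_prod_def C_prod_list_le_iff set_ordered_list)
  show ?thesis
  proof (rule antisym)
    show "C (T J) \<le> J" by (simp add: le_iff)
    show "J \<le> C (T J)" using le_iff[of "C (T J)"] by (auto intro: le_of_generators[of J])
  qed
qed

section \<open>Right multiplication by B_J and A_J\<close>

definition killed :: "'l \<Rightarrow> 'a set" where
  "killed J = {v. \<exists>g\<in>G. \<not> C g \<le> J \<and> C g \<le> D v}"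

text \<open>Where the error terms live: they are killed by \<open>J\<close> and strictly lower in
  height than \<open>u\<close>.\<close>

definition killed_above :: "'l \<Rightarrow> 'a \<Rightarrow> 'a set" where
  "killed_above J u = {v \<in> killed J. height v < height u}"

lemma le_D_omega: "C g \<le> D (v * omega g)"
  using absorb_iff[of "v * omega g" "omega g"] by (simp add: mult.assoc omega_idem)

lemma mult_omega_killed_above:
  assumes "g \<in> G" "\<not> C g \<le> J" "v * omega g \<noteq> v"
  shows "v * omega g \<in> killed_above J v"
  using assms le_D_omega height_mult_less by (auto simp: killed_above_def killed_def)

text \<open>Either \<open>omega g\<close> fixes \<open>v\<close>, and the new factor annihilates
  \<open>emb v\<close>, or \<open>v * omega g\<close> is again killed and even lower.\<close>

lemma supp_killed_above_mult:
  assumes g: "g \<in> G" "\<not> C g \<le> J" and p: "supp p \<subseteq> killed_above J u"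
  shows "supp (p * (1 - emb (omega g))) \<subseteq> killed_above J u"
proof (rule supp_mult_subset)
  fix v assume "v \<in> supp p"
  then have v: "v \<in> killed_above J u" using p by auto
  have eq: "emb v * (1 - emb (omega g)) = emb v - emb (v * omega g)"
    by (simp add: algebra_simps emb_mult)
  show "supp (emb v * (1 - emb (omega g))) \<subseteq> killed_above J u"
  proof (cases "v * omega g = v")
    case False
    then have "v * omega g \<in> killed_above J u"
      using mult_omega_killed_above[OF g] v by (fastforce simp: killed_above_def)
    then show ?thesis
      using v by (simp add: eq supp_diff)
  qed (simp add: eq)
qed

text \<open>The subtracted term is the diagonal part: it drops to \<open>0\<close> at the first
  factor whose generator is absorbed by \<open>u\<close>. Induction runs from the right end because
  the factors act on \<open>emb u\<close> from left to right.\<close>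

lemma supp_prod_list_diff:
  assumes "set xs \<subseteq> {g \<in> G. \<not> C g \<le> J}"
  shows "supp (emb u * prod_list (map (\<lambda>g. 1 - emb (omega g)) xs) -
    (if \<exists>g\<in>set xs. C g \<le> D u then 0 else emb u)) \<subseteq> killed_above J u"
  using assms
proof (induction xs rule: rev_induct)
  case (snoc g xs)
  define p where "p = emb u * prod_list (map (\<lambda>g. 1 - emb (omega g)) xs)"
  define c where "c ys = (if \<exists>g\<in>set ys. C g \<le> D u then 0 else emb u)" for ys
  have g: "g \<in> G" "\<not> C g \<le> J" using snoc.prems by auto
  have 1: "supp ((p - c xs) * (1 - emb (omega g))) \<subseteq> killed_above J u"
    using snoc by (intro supp_killed_above_mult) (auto simp: p_def c_def)
  have 2: "supp (c xs * (1 - emb (omega g)) - c (xs @ [g])) \<subseteq> killed_above J u"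
  proof (cases "\<exists>g\<in>set xs. C g \<le> D u")
    case True
    then have "c xs = 0" "c (xs @ [g]) = 0" by (auto simp: c_def)
    then show ?thesis by simp
  next
    case False
    then have c: "c xs = emb u" "c (xs @ [g]) = (if C g \<le> D u then 0 else emb u)"
      by (auto simp: c_def)
    have eq: "emb u * (1 - emb (omega g)) = emb u - emb (u * omega g)"
      by (simp add: algebra_simps emb_mult)
    show ?thesis
    proof (cases "C g \<le> D u")
      case True
      then have "u * omega g = u" using absorb_iff[of u "omega g"] by simp
      then show ?thesis using True by (simp add: c eq)
    next
      case False
      then have "u * omega g \<in> killed_above J u"
        using absorb_iff[of u "omega g"] by (intro mult_omega_killed_above[OF g]) simp
      then show ?thesis using False by (simp add: c eq)
    qed
  qed
  have "emb u * prod_list (map (\<lambda>g. 1 - emb (omega g)) (xs @ [g])) - c (xs @ [g]) =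
      (p - c xs) * (1 - emb (omega g)) + (c xs * (1 - emb (omega g)) - c (xs @ [g]))"
    by (simp add: p_def algebra_simps)
  then show ?case
    using supp_add[OF 1 2] by (simp only: c_def)
qed simp

lemma
  shows supp_killed_mult_B: "u \<in> killed J \<Longrightarrow> supp (emb u * B J) \<subseteq> killed_above J u"
    and supp_not_killed_mult_B: "u \<notin> killed J \<Longrightarrow> supp (emb u * B J - emb u) \<subseteq> killed_above J u"
proof -
  have "supp (emb u * B J - (if u \<in> killed J then 0 else emb u)) \<subseteq> killed_above J u"
    using supp_prod_list_diff[of "ordered_list r {g \<in> G. \<not> C g \<le> J}" J u]
    by (simp add: set_ordered_list B_elt_def ordered_prod_def killed_def Bex_def conj_assoc)
  then show "u \<in> killed J \<Longrightarrow> supp (emb u * B J) \<subseteq> killed_above J u"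
    "u \<notin> killed J \<Longrightarrow> supp (emb u * B J - emb u) \<subseteq> killed_above J u"
    by simp_all
qed

lemma killed_mult_B_power:
  assumes "supp q \<subseteq> killed J"
  shows "q * B J ^ Suc (card (UNIV :: 'a set)) = 0"
proof -
  have "q * B J ^ Suc (card (UNIV :: 'a set)) * 1 = 0"
    using supp_killed_mult_B assms
    by (intro raising_nilpotent[of "killed J"]) (auto simp: killed_above_def)
  then show ?thesis by simp
qed

lemma one_not_killed: "1 \<notin> killed J"
proof
  assume "1 \<in> killed J"
  then obtain g where "\<not> C g \<le> J" "C g \<le> D 1"
    by (auto simp: killed_def)
  then show False
    using mult_absorb[of g 1] C_one_le[of J] by simp
qed

text \<open>As \<open>1\<close> is not killed, \<open>B J - 1\<close> lies in the killed span, and a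
  high power of \<open>B J\<close> annihilates that span.\<close>

lemma A_eq_power: "A J = B J ^ Suc (card (UNIV :: 'a set))"
  unfolding A_elt_def
proof (rule alg_omega_eq)
  let ?n = "Suc (card (UNIV :: 'a set))"
  have "supp (B J - 1) \<subseteq> killed J"
    using supp_not_killed_mult_B[OF one_not_killed[of J]] by (auto simp: emb_one killed_above_def)
  then have "(B J - 1) * B J ^ ?n = 0"
    by (rule killed_mult_B_power)
  then show "B J ^ (?n + 1) = B J ^ ?n"
    by (simp add: left_diff_distrib)
qed

lemma killed_mult_A: "u \<in> killed J \<Longrightarrow> emb u * A J = 0"
  using killed_mult_B_power[of "emb u" J] by (simp add: A_eq_power)

text \<open>Errors from earlier factors \<open>B J\<close> stay in the span, and each further factor
  adds one of the same kind.\<close>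

lemma supp_not_killed_mult_A:
  assumes "u \<notin> killed J"
  shows "supp (emb u * A J - emb u) \<subseteq> killed_above J u"
proof -
  have "supp (emb u * B J ^ n - emb u) \<subseteq> killed_above J u" for n
  proof (induction n)
    case (Suc n)
    have "supp ((emb u * B J ^ n - emb u) * B J) \<subseteq> killed_above J u"
    proof (rule supp_mult_subset)
      fix v assume "v \<in> supp (emb u * B J ^ n - emb u)"
      then have "v \<in> killed_above J u" using Suc by auto
      then show "supp (emb v * B J) \<subseteq> killed_above J u"
        using supp_killed_mult_B[of v J] by (fastforce simp: killed_above_def)
    qed
    moreover have "emb u * B J ^ Suc n - emb u =
        (emb u * B J ^ n - emb u) * B J + (emb u * B J - emb u)"
      by (simp add: left_diff_distrib power_commutes mult.assoc)
    ultimately show ?case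
      using supp_not_killed_mult_B[OF assms] by (simp only: supp_add)
  qed simp
  then show ?thesis by (simp only: A_eq_power)
qed

section \<open>The elements z_J and P_J\<close>

lemma T_right_le_D: "J \<le> D (v * T J)"
  using absorb_iff[of "v * T J" "T J"] by (simp add: mult.assoc T_idem)

lemma supp_z: "supp (z J) \<subseteq> {v. J \<le> D v}"
  using supp_mult_emb[of "A J" "T J"] T_right_le_D by (auto simp: z_elt_def)

lemma killed_mult_z: "u \<in> killed J \<Longrightarrow> emb u * z J = 0"
  using killed_mult_A by (simp add: z_elt_def flip: mult.assoc)

lemma z_nilpotent_part:
  "(1 - z J) ^ Suc (card (UNIV :: 'a set)) * (z J)\<^sup>2 = 0"
proof -
  let ?n = "Suc (card (UNIV :: 'a set))"
  have comm: "(1 - z J) * z J = z J * (1 - z J)"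
    by (simp add: algebra_simps)
  \<comment> \<open>The left \<open>z J\<close> brings the support into the set fixed by
    \<open>T J\<close>; the right one annihilates the killed elements. On the others,
    \<open>1 - z J\<close> leaves only the error of \<open>A J\<close>, multiplied by
    \<open>T J\<close>, which never raises height.\<close>
  have "z J * (1 - z J) ^ ?n * z J = 0"
  proof (rule raising_nilpotent[of "{v. J \<le> D v}", OF _ comm supp_z])
    fix u assume "u \<in> {v. J \<le> D v}"
    then have u: "u * T J = u" using absorb_iff[of u "T J"] by simp
    show "emb u * z J = 0 \<or>
      supp (emb u * (1 - z J)) \<subseteq> {v \<in> {v. J \<le> D v}. height v < height u}"
    proof (cases "u \<in> killed J")
      case False
      have "emb u * (1 - z J) = 0 - (emb u * A J - emb u) * emb (T J)"
        by (simp add: z_elt_def algebra_simps u flip: emb_mult)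
      moreover have "supp ((emb u * A J - emb u) * emb (T J)) \<subseteq>
          {v \<in> {v. J \<le> D v}. height v < height u}"
      proof (rule supp_mult_subset)
        fix v assume "v \<in> supp (emb u * A J - emb u)"
        then have "height v < height u"
          using supp_not_killed_mult_A[OF False] by (auto simp: killed_above_def)
        then show "supp (emb v * emb (T J)) \<subseteq> {v \<in> {v. J \<le> D v}. height v < height u}"
          using T_right_le_D le_less_trans[OF height_mult_le] by (simp flip: emb_mult)
      qed
      ultimately show ?thesis by simp
    qed (simp add: killed_mult_z)
  qed
  then show ?thesis
    by (simp only: power2_eq_square mult.assoc[symmetric] power_commuting_commutes[OF comm])
qed

text \<open>The truncated geometric series: \<open>geo J * z J\<close> is \<open>1\<close> minus a
  power of \<open>1 - z J\<close>.\<close>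

definition geo :: "'l \<Rightarrow> 'a monoid_algebra" where
  "geo J = (\<Sum>n<Suc (card (UNIV :: 'a set)). (1 - z J) ^ n)"

lemma geo_commute: "geo J * z J = z J * geo J"
proof -
  have "(1 - z J) * z J = z J * (1 - z J)"
    by (simp add: algebra_simps)
  then show ?thesis
    by (simp only: geo_def sum_distrib_left sum_distrib_right power_commuting_commutes)
qed

lemma geo_left_commute: "geo J * (z J * x) = z J * (geo J * x)"
  by (simp only: geo_commute mult.assoc[symmetric])

lemmas geo_normalize = mult.assoc geo_commute geo_left_commute

text \<open>Summands with \<open>n\<close> or \<open>m\<close> beyond the cutoff vanish by
  \<open>z_nilpotent_part\<close>; on the remaining square of indices the double sum
  factors.\<close>

lemma P_eq: "P J = geo J * geo J * (z J * z J)"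
proof -
  let ?n = "Suc (card (UNIV :: 'a set))"
  have zero: "(1 - z J) ^ m * (z J)\<^sup>2 = 0" if "m \<ge> ?n" for m
  proof -
    have "(1 - z J) ^ m = (1 - z J) ^ (m - ?n) * (1 - z J) ^ ?n"
      using that by (simp flip: power_add del: power_Suc)
    then show ?thesis by (simp only: mult.assoc z_nilpotent_part mult_zero_right)
  qed
  have "P J = (\<Sum>(n, m)\<in>{..<?n} \<times> {..<?n}. (1 - z J) ^ (n + m) * (z J)\<^sup>2)"
    unfolding P_elt_def
  proof (rule Sum_any.expand_superset)
    show "{a. (case a of (n, m) \<Rightarrow> (1 - z J) ^ (n + m) * (z J)\<^sup>2) \<noteq> 0} \<subseteq> {..<?n} \<times> {..<?n}"
      using zero by (auto simp del: power_Suc) (meson not_less trans_le_add1 trans_le_add2)+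
  qed simp
  also have "\<dots> = (\<Sum>n<?n. \<Sum>m<?n. (1 - z J) ^ n * (1 - z J) ^ m) * (z J)\<^sup>2"
    by (simp only: sum.cartesian_product[symmetric] power_add sum_distrib_right)
  also have "\<dots> = geo J * geo J * (z J * z J)"
    by (simp only: geo_def sum_product power2_eq_square)
  finally show ?thesis .
qed

lemma P_eq_square: "P J = (1 - (1 - z J) ^ Suc (card (UNIV :: 'a set)))\<^sup>2"
proof -
  have "P J = (geo J * z J) * (geo J * z J)"
    by (simp only: P_eq geo_normalize)
  then show ?thesis
    by (simp only: geo_def sum_power_one_minus_mult power2_eq_square)
qed

lemma P_idem: "P J * P J = P J"
proof -
  define w where "w = (1 - z J) ^ Suc (card (UNIV :: 'a set))"
  have w: "w * (z J * z J) = 0"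
    using z_nilpotent_part by (simp add: w_def power2_eq_square)
  \<comment> \<open>Here \<open>P J\<close> is the square of \<open>1 - w\<close>, and
    \<open>w\<close> annihilates \<open>z J * z J\<close>. Since \<open>P J\<close> itself starts
    with \<open>z J * z J\<close>, it is idempotent.\<close>
  have "P J * (z J * z J) = z J * z J"
    by (simp add: P_eq_square w_def[symmetric] power2_eq_square algebra_simps w
        del: power_Suc)
  moreover have "P J = (z J * z J) * (geo J * geo J)"
    by (simp only: P_eq geo_normalize)
  ultimately show ?thesis by (metis mult.assoc)
qed

lemma P_left: "P J = z J * (geo J * geo J * z J)"
  by (simp only: P_eq geo_normalize)

section \<open>Character values\<close>

lemma chi_B: "chi C d (B J) = (if d \<le> J then 1 else 0)"
proof -
  have list: "chi C d (prod_list (map (\<lambda>g. 1 - emb (omega g)) xs)) =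
      (if \<exists>g\<in>set xs. C g \<le> d then 0 else 1)" for xs
    by (induction xs) auto
  have "(\<exists>g\<in>G. \<not> C g \<le> J \<and> C g \<le> d) \<longleftrightarrow> \<not> d \<le> J"
    using le_of_generators[of d J] order_trans by blast
  then show ?thesis
    by (auto simp: B_elt_def ordered_prod_def list set_ordered_list)
qed

text \<open>The factor \<open>A J\<close> contributes the condition \<open>d \<le> J\<close>, the
  factor \<open>T J\<close> the condition \<open>J \<le> d\<close>.\<close>

lemma chi_z: "chi C d (z J) = (if d = J then 1 else 0)"
  by (auto simp: z_elt_def A_eq_power chi_B)

lemma chi_P: "chi C d (P J) = (if d = J then 1 else 0)"
  by (simp add: P_eq_square chi_z)

lemma chi_e: "chi C d (e J) = (if d = J then 1 else 0)"
proof (induction J rule: measure_induct_rule[of "\<lambda>J. card {K. J < K}"])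
  case (less J)
  have "card {L. K < L} < card {L. J < L}" if "J < K" for K
    using that by (intro psubset_card_mono) auto
  then have "chi C d (e K) = (if d = K then 1 else 0)" if "J < K" for K
    using less that by blast
  then have "chi C d (e J) = (if d = J then 1 else 0) *
      (1 - (\<Sum>K | J < K. if d = K then 1 else 0))"
    by (subst e_elt.simps) (simp add: chi_P chi_sum)
  then show ?case by auto
qed

section \<open>Orthogonality\<close>

lemma killed_mult_e: "v \<in> killed J \<Longrightarrow> emb v * e J = 0"
  by (subst e_elt.simps) (simp add: P_left killed_mult_z flip: mult.assoc)

lemma P_mult_e: "P J * e J = e J"
  by (metis P_idem e_elt.simps mult.assoc)

text \<open>\<open>P K\<close> ends in \<open>T K\<close>, which absorbs every generator below
  \<open>K\<close>; one of these is not below \<open>J\<close>.\<close>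

lemma P_mult_e_eq_0:
  assumes "\<not> K \<le> J"
  shows "P K * e J = 0"
proof -
  have "K \<le> D (T K)"
    using T_right_le_D[of K "T K"] by (simp add: T_idem)
  then have "T K \<in> killed J"
    using assms le_of_generators[of K J] order_trans unfolding killed_def by blast
  then show ?thesis
    by (simp add: P_eq z_elt_def mult.assoc killed_mult_e)
qed

lemma e_mult_e_expand: "e K * e J = P K * (e J - (\<Sum>L | K < L. e L * e J))"
  by (subst e_elt.simps) (simp add: mult.assoc left_diff_distrib sum_distrib_right)

lemma e_mult_e: "e K * e J = (if K = J then e J else 0)"
proof (induction K rule: measure_induct_rule[of "\<lambda>K. card {L. K < L}"])
  case (less K)
  have "card {M. L < M} < card {L. K < L}" if "K < L" for L
    using that by (intro psubset_card_mono) auto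
  then have "e L * e J = (if L = J then e J else 0)" if "K < L" for L
    using less that by blast
  then have "e K * e J = P K * (e J - (\<Sum>L | K < L. if L = J then e J else 0))"
    by (subst e_mult_e_expand) simp
  also have "\<dots> = P K * (e J - (if K < J then e J else 0))"
    by simp
  \<comment> \<open>For \<open>K < J\<close> the bracket is \<open>0\<close>; for
    \<open>K = J\<close> the factor \<open>P J\<close> fixes \<open>e J\<close>; otherwise
    \<open>K\<close> is not below \<open>J\<close> and \<open>P K\<close> annihilates
    \<open>e J\<close>.\<close>
  also have "\<dots> = (if K = J then e J else 0)"
    using P_mult_e[of J] P_mult_e_eq_0[of K J] by auto
  finally show ?case .
qed

section \<open>Primitivity and completeness\<close>

lemma e_primitive: "primitive (e J)"
  unfolding primitive_def
proof (intro allI impI)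
  fix x y assume *: "x * x = x \<and> y * y = y \<and> x * y = 0 \<and> y * x = 0 \<and> e J = x + y"
  have sq: "chi C d x * chi C d x = chi C d x" "chi C d y * chi C d y = chi C d y"
    "chi C d x * chi C d y = 0" for d
    using * chi_mult[of d x x] chi_mult[of d y y] chi_mult[of d x y] by auto
  have sum: "chi C d x + chi C d y = (if d = J then 1 else 0)" for d
    using * chi_e[of d J] by simp
  have other: "chi C d x = 0" "chi C d y = 0" if "d \<noteq> J" for d
    using sq[of d] sum[of d] that by auto
  \<comment> \<open>Only the character at \<open>J\<close> can be nonzero on \<open>x\<close> or
    \<open>y\<close>, and it cannot be so on both; the summand on which it vanishes is
    \<open>0\<close>.\<close>
  have "chi C J x = 0 \<or> chi C J y = 0"
    using sq(3)[of J] by simp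
  then show "x = 0 \<or> y = 0"
    using * other idempotent_eq_0[of x] idempotent_eq_0[of y] by metis
qed

text \<open>By orthogonality \<open>1 - s\<close> is idempotent, and each character takes the value
  \<open>1\<close> on exactly one \<open>e J\<close>, so all of them vanish on
  \<open>1 - s\<close>.\<close>

lemma sum_e: "(\<Sum>J\<in>UNIV. e J) = 1"
proof -
  define s where "s = (\<Sum>J\<in>UNIV. e J)"
  have "s * s = s"
    by (simp add: s_def sum_product e_mult_e)
  then have "(1 - s) * (1 - s) = 1 - s"
    by (simp add: algebra_simps)
  moreover have "chi C d (1 - s) = 0" for d
    by (simp add: s_def chi_sum chi_e)
  ultimately have "1 - s = 0"
    by (rule idempotent_eq_0)
  then show ?thesis by (simp add: s_def)
qed

lemma complete_e: "complete_primitive_orthogonal_idempotents UNIV e"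
proof -
  have "e J \<noteq> 0" for J
    using chi_e[of J J] by auto
  then show ?thesis
    by (simp add: complete_primitive_orthogonal_idempotents_def power2_eq_square e_mult_e
        e_primitive sum_e)
qed

end

theorem theorem3p27:
  fixes C D :: "'a::{monoid_mult, finite} \<Rightarrow> 'l::{semilattice_sup, finite}"
    and G :: "'a set" and r :: "'a rel"
  assumes "weakly_ordered_monoid C D"
    and "generates G"
    and "linear_order_on G r"
  shows "complete_primitive_orthogonal_idempotents UNIV (e_elt G r C)"
proof -
  interpret ordered_generators C D G r
    using assms by (simp add: ordered_generators_def ordered_generators_axioms_def)
  show ?thesis by (rule complete_e)
qed

end
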